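(* The truncated real exceptional set $$\mathcal{E}_T(\mathbb{R}_+) := \{\lambda \in \mathbb{R},\ \lambda>0 : \text{for infinitely many integers } n\ge 0, \text{ the ternary expansion } (\lfloor \lambda 2^n\rfloor)_3 \text{ omits the digit } 2\}$$ has Hausdorff dimension $$\dim_H(\mathcal{E}_T(\mathbb{R}_+)) = \log_3 2 = \frac{\log 2}{\log 3},$$ and it has nonzero $(\log_3 2)$-dimensional Hausdorff measure.
   Context: For a nonnegative integer $k$, $(k)_3$ denotes its ternary (base 3) digit expansion, with digits in $\{0,1,2\}$; it "omits the digit 2" if every digit is $0$ or $1$. Hausdorff dimension and measure are with respect to the usual metric on $\mathbb{R}$. *)

theory Defs
  imports "HOL-Analysis.Analysis"
begin

definition ternary_digit :: "nat \<Rightarrow> nat \<Rightarrow> nat" where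
  "ternary_digit k i = (k div 3 ^ i) mod 3"

lemma ternary_expansion:
  assumes "k < 3 ^ m"
  shows "k = (\<Sum>i<m. ternary_digit k i * 3 ^ i)"
proof -
  have "k mod 3 ^ m = (\<Sum>i<m. ternary_digit k i * 3 ^ i)"
    by (induction m)
      (simp_all add: ternary_digit_def mod_mult2_eq mult.commute[of 3])
  with assms show ?thesis by simp
qed

text \<open>The quantifier below also covers the leading zeros, which are never equal to 2.\<close>

definition omits_digit_two :: "nat \<Rightarrow> bool" where
  "omits_digit_two k \<longleftrightarrow> (\<forall>i. ternary_digit k i \<in> {0, 1})"

text \<open>
  In the next definition, the function \<^const>\<open>nat\<close> does not truncate, since
  the floor of a positive real is nonnegative.
\<close>

definition truncated_exceptional_set :: "real set" where
  "truncated_exceptional_set =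
    {l. l > 0 \<and> infinite {n::nat. omits_digit_two (nat \<lfloor>l * 2 ^ n\<rfloor>)}}"

text \<open>
  The \<open>s\<close>-th power of the diameter, with the usual conventions that the empty set
  contributes 0 and that \<open>0\<^sup>0 = 1\<close>; the latter must be spelled out because
  \<^prop>\<open>0 powr 0 = (0::real)\<close>.
\<close>

definition diameter_power :: "real \<Rightarrow> 'a::metric_space set \<Rightarrow> ennreal" where
  "diameter_power s U =
    (if U = {} then 0 else if s = 0 then 1 else ennreal (diameter U powr s))"

text \<open>
  Boundedness of the covering sets is required explicitly because
  \<^const>\<open>diameter\<close> is real-valued and carries no meaning on unbounded sets. Finite covers are
  included, since members of the sequence may be empty.
\<close>

definition hausdorff_premeasure :: "real \<Rightarrow> real \<Rightarrow> 'a::metric_space set \<Rightarrow> ennreal" where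
  "hausdorff_premeasure s d A =
    (INF U \<in> {U :: nat \<Rightarrow> 'a set.
        (\<forall>i. bounded (U i) \<and> diameter (U i) \<le> d) \<and> A \<subseteq> (\<Union>i. U i)}.
      \<Sum>i. diameter_power s (U i))"

definition hausdorff_measure :: "real \<Rightarrow> 'a::metric_space set \<Rightarrow> ennreal" where
  "hausdorff_measure s A = (SUP d \<in> {0<..}. hausdorff_premeasure s d A)"

definition hausdorff_dim :: "'a::metric_space set \<Rightarrow> ennreal" where
  "hausdorff_dim A = Inf {ennreal s |s. s \<ge> 0 \<and> hausdorff_measure s A = 0}"

end

theory Submission
  imports Defs
begin

text \<open>
  Upper bound: among the integers below \<open>M\<close> at most \<open>2 M\<^sup>\<alpha>\<close> omit the digit 2, where
  \<open>\<alpha> = log\<^sub>3 2\<close>, so for \<open>s > \<alpha>\<close> the intervals \<open>[m/2\<^sup>n, (m+1)/2\<^sup>n]\<close> with \<open>m < (n+1) 2\<^sup>n\<close>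
  omitting the digit 2 and \<open>n \<ge> N\<close> form covers whose sums of \<open>s\<close>-th powers tend to 0.

  Lower bound: the quotients \<open>3\<^sup>L/2\<^sup>n\<close> are dense in the positive reals, so by Baire's theorem there
  is a \<open>\<theta> > 0\<close> with \<open>3\<^sup>L < \<theta> 2\<^sup>n < 3\<^sup>L + 1\<close> for infinitely many \<open>n\<close>. If \<open>c\<close> is a nonzero real
  with ternary digits 0 and 1 only, then \<open>3\<^sup>L c\<close> has fractional part at most 1/2 and
  \<open>c (\<theta> 2\<^sup>n - 3\<^sup>L) < 1/2\<close>; hence \<open>\<theta> c 2\<^sup>n\<close> and \<open>3\<^sup>L c\<close> have the same integer part, and this omits
  the digit 2. So the exceptional set contains a scaled Cantor set, apart from the point 0, and
  reading binary digits as ternary ones shows that it has positive \<open>\<alpha>\<close>-dimensional measure.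
\<close>

section \<open>Numbers omitting the digit 2\<close>

lemma omits_digit_two_0: "omits_digit_two 0"
  by (simp add: omits_digit_two_def ternary_digit_def)

lemma ternary_digit_snoc:
  assumes "d < 3"
  shows "ternary_digit (3 * k + d) 0 = d" "ternary_digit (3 * k + d) (Suc i) = ternary_digit k i"
  using assms by (simp_all add: ternary_digit_def div_mult2_eq)

lemma omits_digit_two_snoc_iff:
  assumes "d < 3"
  shows "omits_digit_two (3 * k + d) \<longleftrightarrow> omits_digit_two k \<and> d \<le> 1"
proof -
  have "omits_digit_two (3 * k + d) \<longleftrightarrow>
      ternary_digit (3 * k + d) 0 \<in> {0, 1} \<and> (\<forall>i. ternary_digit (3 * k + d) (Suc i) \<in> {0, 1})"
    unfolding omits_digit_two_def by (metis not0_implies_Suc)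
  then show ?thesis
    unfolding ternary_digit_snoc[OF assms] omits_digit_two_def by auto
qed

text \<open>Deleting the last digit leaves an admissible number with one digit less, and only 0 and
  1 can be appended to it, so each further place at most doubles the count.\<close>

lemma card_omits_digit_two_less_power:
  "card {m. m < 3 ^ L \<and> omits_digit_two m} \<le> 2 ^ L"
proof (induction L)
  case 0
  have "{m::nat. m < 3 ^ 0 \<and> omits_digit_two m} \<subseteq> {0}" by auto
  from card_mono[OF _ this] show ?case by simp
next
  case (Suc L)
  let ?A = "{m. m < 3 ^ L \<and> omits_digit_two m}"
  have "{m. m < 3 ^ Suc L \<and> omits_digit_two m} \<subseteq> (\<lambda>k. 3 * k) ` ?A \<union> (\<lambda>k. 3 * k + 1) ` ?A"
  proof
    fix m assume m: "m \<in> {m. m < 3 ^ Suc L \<and> omits_digit_two m}"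
    define k d where "k = m div 3" and "d = m mod 3"
    have mkd: "m = 3 * k + d" "d < 3" by (auto simp: k_def d_def)
    with m have "omits_digit_two k" "d \<le> 1"
      using omits_digit_two_snoc_iff by auto
    moreover have "k < 3 ^ L"
      using m mkd by auto
    moreover have "d = 0 \<or> d = 1" using \<open>d \<le> 1\<close> by auto
    ultimately show "m \<in> (\<lambda>k. 3 * k) ` ?A \<union> (\<lambda>k. 3 * k + 1) ` ?A"
      using mkd(1) by auto
  qed
  moreover have fin: "finite ?A" by simp
  ultimately have "card {m. m < 3 ^ Suc L \<and> omits_digit_two m}
      \<le> card ((\<lambda>k. 3 * k) ` ?A \<union> (\<lambda>k. 3 * k + 1) ` ?A)"
    by (intro card_mono) auto
  also have "\<dots> \<le> card ((\<lambda>k. 3 * k) ` ?A) + card ((\<lambda>k. 3 * k + 1) ` ?A)"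
    by (rule card_Un_le)
  also have "\<dots> \<le> card ?A + card ?A"
    by (intro add_mono card_image_le fin)
  also have "\<dots> \<le> 2 ^ Suc L" using Suc by simp
  finally show ?case .
qed

text \<open>This is why \<open>log 3 2\<close> is the critical exponent: it turns the scale factor 3
  of each digit into the factor 2 in the number of digit strings.\<close>

lemma three_power_powr: "(3 ^ L :: real) powr (log 3 2) = 2 ^ L"
proof -
  have "(3 ^ L :: real) powr (log 3 2) = (3 powr real L) powr log 3 2"
    by (simp add: powr_realpow)
  also have "\<dots> = (3 powr log 3 2) powr real L"
    by (simp only: powr_powr mult.commute)
  finally show ?thesis by (simp add: powr_realpow)
qed

lemma card_omits_digit_two_less:
  assumes "M \<ge> 1"
  shows "real (card {m. m < M \<and> omits_digit_two m}) \<le> 2 * real M powr log 3 2"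
proof -
  \<comment> \<open>\<open>3 ^ L\<close> is \<open>M\<close> rounded up to a power of 3. This costs
    a factor of at most 3, which the exponent \<open>log 3 2\<close> turns into the factor 2 of the
    bound.\<close>
  define L where "L = nat \<lceil>log 3 (real M)\<rceil>"
  have log0: "log 3 (real M) \<ge> 0" using assms by simp
  have L: "log 3 (real M) \<le> real L" "real L \<le> log 3 (real M) + 1"
    using log0 unfolding L_def by linarith+
  have "real M \<le> 3 powr real L"
    using L(1) assms by (simp add: log_le_iff)
  then have M_le: "M \<le> 3 ^ L"
    by (simp add: powr_realpow)
  have "3 powr real L \<le> 3 powr (log 3 (real M) + 1)"
    using L(2) by simp
  also have "\<dots> = 3 * real M"
    using assms by (simp add: powr_add)
  finally have le_M: "3 ^ L \<le> 3 * real M" by (simp add: powr_realpow)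
  have "{m. m < M \<and> omits_digit_two m} \<subseteq> {m. m < 3 ^ L \<and> omits_digit_two m}"
    using M_le by auto
  then have "card {m. m < M \<and> omits_digit_two m} \<le> card {m. m < 3 ^ L \<and> omits_digit_two m}"
    by (intro card_mono) auto
  then have "card {m. m < M \<and> omits_digit_two m} \<le> 2 ^ L"
    using card_omits_digit_two_less_power le_trans by blast
  then have "real (card {m. m < M \<and> omits_digit_two m}) \<le> 2 ^ L"
    by (metis of_nat_le_iff of_nat_numeral of_nat_power)
  also have "\<dots> = (3 ^ L) powr log 3 2" by (simp add: three_power_powr)
  also have "\<dots> \<le> (3 * real M) powr log 3 2"
    using le_M by (intro powr_mono2) auto
  also have "\<dots> = 2 * real M powr log 3 2"
    by (simp add: powr_mult)
  finally show ?thesis .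
qed

section \<open>The upper bound\<close>

lemma hausdorff_measure_truncated_exceptional_set_eq_0:
  assumes s: "s > log 3 2"
  shows "hausdorff_measure s truncated_exceptional_set = 0"
proof -
  \<comment> \<open>Level \<open>k\<close> has at most
    \<open>2 * ((k + 1) * 2 ^ k) powr log 3 2\<close> intervals of length \<open>1 / 2 ^ k\<close>.
    Their \<open>s\<close>-th powers add up to at most
    \<open>2 * (k + 1) powr log 3 2 * z ^ k\<close>, and \<open>a k\<close> bounds this since
    \<open>log 3 2\<close> is below 1.\<close>
  define z :: real where "z = 2 powr (log 3 2 - s)"
  define a where "a n = 2 * (real (Suc n) * z ^ n)" for n
  have s0: "s > 0" using s zero_less_log_cancel_iff[of 3 2] by linarith
  have "z < 1" "z > 0" using s unfolding z_def by (auto intro: powr_less_one)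
  then have "summable (\<lambda>n. real (Suc n) * z ^ n)"
    using geometric_deriv_sums[of z] sums_summable by auto
  then have summ: "summable a"
    unfolding a_def by (rule summable_mult)
  have a0: "a n \<ge> 0" for n using \<open>z > 0\<close> by (simp add: a_def)
  \<comment> \<open>The level is \<open>n + N\<close>, so \<open>N\<close> discards the coarse
    intervals. The bound on \<open>m\<close> keeps each level \<open>k\<close> finite by reaching
    only up to \<open>k + 1\<close>; every positive real is still in range at all large
    levels.\<close>
  define U :: "nat \<Rightarrow> nat \<times> nat \<Rightarrow> real set" where
    "U N = (\<lambda>(n, m). if m < Suc (n + N) * 2 ^ (n + N) \<and> omits_digit_two m
       then {real m / 2 ^ (n + N)..real (Suc m) / 2 ^ (n + N)} else {})" for N
  have diam: "bounded (U N p) \<and> diameter (U N p) \<le> 1 / 2 ^ (fst p + N)" for N p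
    by (cases p) (auto simp: U_def add_divide_distrib)
  have inner: "(\<Sum>m. diameter_power s (U N (n, m))) \<le> ennreal (a (n + N))" for N n
  proof -
    define k M where "k = n + N" and "M = Suc k * 2 ^ k"
    let ?A = "{m. m < M \<and> omits_digit_two m}"
    have M: "M \<ge> 1" by (simp add: M_def Suc_le_eq)
    have "(\<Sum>m. diameter_power s (U N (n, m))) = (\<Sum>m\<in>?A. diameter_power s (U N (n, m)))"
      by (rule suminf_finite) (auto simp: U_def diameter_power_def M_def k_def)
    also have "\<dots> \<le> (\<Sum>m\<in>?A. ennreal ((1 / 2 ^ k) powr s))"
    proof (rule sum_mono)
      fix m
      have "diameter (U N (n, m)) powr s \<le> (1 / 2 ^ k) powr s"
        using diam[of N "(n, m)"] s0 by (intro powr_mono2 diameter_ge_0) (auto simp: k_def)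
      then show "diameter_power s (U N (n, m)) \<le> ennreal ((1 / 2 ^ k) powr s)"
        using s0 by (auto simp: diameter_power_def intro: ennreal_leI)
    qed
    also have "\<dots> = ennreal (real (card ?A) * (1 / 2 ^ k) powr s)"
      by (simp add: ennreal_mult ennreal_of_nat_eq_real_of_nat)
    also have "\<dots> \<le> ennreal (a k)"
    proof (rule ennreal_leI)
      have "real (card ?A) * (1 / 2 ^ k) powr s \<le> 2 * real M powr log 3 2 * (1 / 2 ^ k) powr s"
        using card_omits_digit_two_less[OF M] by (intro mult_right_mono) auto
      also have "real M powr log 3 2 = real (Suc k) powr log 3 2 * (2 ^ k) powr log 3 2"
        unfolding M_def by (simp only: of_nat_mult of_nat_power of_nat_numeral powr_mult)
      also have "2 * (real (Suc k) powr log 3 2 * (2 ^ k) powr log 3 2) * (1 / 2 ^ k) powr s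
          = 2 * (real (Suc k) powr log 3 2 * ((2 ^ k) powr log 3 2 * (1 / 2 ^ k) powr s))"
        by (simp only: mult.assoc)
      also have "(2 ^ k) powr log 3 2 * (1 / 2 ^ k) powr s = z ^ k"
      proof -
        have "z ^ k = (2 powr log 3 2) ^ k * (2 powr (- s)) ^ k"
          unfolding z_def by (simp add: powr_add[symmetric] power_mult_distrib[symmetric])
        also have "\<dots> = (2 ^ k) powr log 3 2 * (1 / 2 ^ k) powr s"
          by (simp add: powr_power powr_divide powr_minus_divide power_one_over[symmetric] power_divide
              flip: powr_realpow) (simp add: powr_powr mult.commute)
        finally show ?thesis by simp
      qed
      also have "2 * (real (Suc k) powr log 3 2 * z ^ k) \<le> 2 * (real (Suc k) powr 1 * z ^ k)"
        using \<open>z > 0\<close> by (intro mult_left_mono mult_right_mono powr_mono) auto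
      finally show "real (card ?A) * (1 / 2 ^ k) powr s \<le> a k"
        by (simp add: a_def)
    qed
    finally show ?thesis by (simp add: k_def)
  qed
  have total: "(\<Sum>i. diameter_power s (U N (prod_decode i))) \<le> ennreal (\<Sum>n. a (n + N))" for N
  proof -
    have "(\<Sum>i. diameter_power s (U N (prod_decode i))) = (\<Sum>n. \<Sum>m. diameter_power s (U N (n, m)))"
      using suminf_ennreal_2dimen[of "\<lambda>n. \<Sum>m. diameter_power s (U N (n, m))"
          "\<lambda>p. diameter_power s (U N p)"] by simp
    also have "\<dots> \<le> (\<Sum>n. ennreal (a (n + N)))"
      by (intro suminf_le inner) auto
    also have "\<dots> = ennreal (\<Sum>n. a (n + N))"
      using summ a0 by (intro suminf_ennreal2) (auto simp: summable_iff_shift)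
    finally show ?thesis .
  qed
  have cover: "truncated_exceptional_set \<subseteq> (\<Union>i. U N (prod_decode i))" for N
  proof
    fix l assume "l \<in> truncated_exceptional_set"
    then have l: "l > 0" "infinite {n::nat. omits_digit_two (nat \<lfloor>l * 2 ^ n\<rfloor>)}"
      by (auto simp: truncated_exceptional_set_def)
    \<comment> \<open>\<open>k > N\<close> makes this level part of \<open>U N\<close>, and
      \<open>k\<close> beyond the ceiling of \<open>l\<close> puts \<open>l\<close> below
      \<open>k + 1\<close>.\<close>
    then obtain k where k: "k > max N (nat \<lceil>l\<rceil>)" "omits_digit_two (nat \<lfloor>l * 2 ^ k\<rfloor>)"
      unfolding infinite_nat_iff_unbounded by blast
    define m where "m = nat \<lfloor>l * 2 ^ k\<rfloor>"
    have "l * 2 ^ k \<ge> 0" using l by simp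
    then have m: "real m \<le> l * 2 ^ k" "l * 2 ^ k < real m + 1"
      unfolding m_def by linarith+
    have "l < real (Suc k)" using k(1) by linarith
    then have "l * 2 ^ k < real (Suc k) * 2 ^ k" by (intro mult_strict_right_mono) auto
    with m(1) have "real m < real (Suc k) * 2 ^ k" by (rule order_le_less_trans)
    then have "real m < real (Suc k * 2 ^ k)" by (simp only: of_nat_mult of_nat_power of_nat_numeral)
    then have "m < Suc k * 2 ^ k" by (simp only: of_nat_less_iff)
    moreover have "k - N + N = k" using k(1) by simp
    moreover have "real m / 2 ^ k \<le> l" "l \<le> real (Suc m) / 2 ^ k"
      using m by (auto simp: field_simps)
    ultimately have "l \<in> U N (k - N, m)"
      using k(2) by (simp add: U_def m_def[symmetric] del: mult_Suc of_nat_Suc)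
    then show "l \<in> (\<Union>i. U N (prod_decode i))"
      by (metis UN_iff UNIV_I prod_encode_inverse)
  qed
  have "hausdorff_premeasure s d truncated_exceptional_set = 0" if d: "d > 0" for d
  proof -
    have "hausdorff_premeasure s d truncated_exceptional_set \<le> ennreal (\<Sum>n. a (n + N))"
      if N: "1 / 2 ^ N \<le> d" for N
    proof -
      have "diameter (U N p) \<le> d" for p
      proof -
        have "(1::real) / 2 ^ (fst p + N) \<le> 1 / 2 ^ N"
          by (intro divide_left_mono power_increasing) auto
        then show ?thesis using diam[of N p] N by linarith
      qed
      then have "hausdorff_premeasure s d truncated_exceptional_set
          \<le> (\<Sum>i. diameter_power s (U N (prod_decode i)))"
        unfolding hausdorff_premeasure_def using diam cover
        by (intro INF_lower) auto
      then show ?thesis using total order_trans by blast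
    qed
    moreover have "eventually (\<lambda>N. (1::real) / 2 ^ N \<le> d) sequentially"
    proof -
      have "(\<lambda>N. (1 / 2 :: real) ^ N) \<longlonglongrightarrow> 0" by (intro LIMSEQ_power_zero) auto
      then have "eventually (\<lambda>N. (1 / 2 :: real) ^ N < d) sequentially"
        using d by (rule order_tendstoD)
      then show ?thesis by eventually_elim (simp add: power_one_over)
    qed
    ultimately have "eventually (\<lambda>N. hausdorff_premeasure s d truncated_exceptional_set
        \<le> ennreal (\<Sum>n. a (n + N))) sequentially"
      by (simp add: eventually_mono)
    \<comment> \<open>The bounds are tails of a convergent series, so for each fixed
      \<open>d\<close> they force the premeasure to 0.\<close>
    moreover have "(\<lambda>N. ennreal (\<Sum>n. a (n + N))) \<longlonglongrightarrow> ennreal 0"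
      using suminf_exist_split2[OF summ] by (rule tendsto_ennrealI)
    ultimately have "hausdorff_premeasure s d truncated_exceptional_set \<le> ennreal 0"
      by (intro tendsto_lowerbound) auto
    then show ?thesis by simp
  qed
  then show ?thesis by (simp add: hausdorff_measure_def)
qed

section \<open>Hoelder parametrizations\<close>

text \<open>A cover of \<open>A\<close> pulls back along \<open>g\<close> to a cover of the unit interval, which has Lebesgue measure 1.\<close>

lemma hausdorff_measure_nonzero_of_Hoelder:
  fixes g :: "real \<Rightarrow> 'a::metric_space"
  assumes g: "g ` {0<..<1} \<subseteq> A" and C: "C > 0" and s: "0 \<le> s" "s \<le> \<alpha>"
    and hoelder: "\<And>x y. x \<in> {0<..<1} \<Longrightarrow> y \<in> {0<..<1} \<Longrightarrow> dist x y \<le> C * dist (g x) (g y) powr \<alpha>"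
  shows "hausdorff_measure s A \<noteq> 0"
proof -
  have "ennreal (1 / (2 * C)) \<le> (\<Sum>i. diameter_power s (U i))"
    if U: "\<forall>i. bounded (U i) \<and> diameter (U i) \<le> 1" "A \<subseteq> (\<Union>i. U i)" for U :: "nat \<Rightarrow> 'a set"
  proof -
    define V where "V i = {x \<in> {0<..<1}. g x \<in> U i}" for i
    \<comment> \<open>\<open>V i\<close> may fail to be measurable, as \<open>g\<close> is
      arbitrary. The Hoelder bound encloses it in a ball about any one of its points.\<close>
    define W where "W i = (if V i = {} then {} else
      cball (SOME x. x \<in> V i) (C * diameter (U i) powr \<alpha>))" for i
    have VW: "V i \<subseteq> W i" for i
    proof
      fix y assume y: "y \<in> V i"
      define x where "x = (SOME x. x \<in> V i)"
      have x: "x \<in> V i" unfolding x_def using y by (rule someI)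
      have "dist (g x) (g y) \<le> diameter (U i)"
        using U(1) x y by (intro diameter_bounded_bound) (auto simp: V_def)
      then have "dist (g x) (g y) powr \<alpha> \<le> diameter (U i) powr \<alpha>"
        using s by (intro powr_mono2) auto
      then have "C * dist (g x) (g y) powr \<alpha> \<le> C * diameter (U i) powr \<alpha>"
        using C by simp
      then have "dist x y \<le> C * diameter (U i) powr \<alpha>"
        using hoelder[of x y] x y by (auto simp: V_def)
      then show "y \<in> W i" using y by (auto simp: W_def x_def)
    qed
    have W: "emeasure lborel (W i) \<le> ennreal (2 * C) * diameter_power s (U i)" for i
    proof (cases "V i = {}")
      case False
      then have ne: "U i \<noteq> {}" by (auto simp: V_def)
      have d: "0 \<le> diameter (U i)" "diameter (U i) \<le> 1"
        using U(1) by (auto intro: diameter_ge_0)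
      \<comment> \<open>Covers are taken at scale 1 so that powers of the diameters do not increase
        with the exponent, which allows all \<open>s \<le> \<alpha>\<close>. The case
        \<open>s = 0\<close> rests on the convention for \<open>diameter_power\<close>.\<close>
      have "ennreal (diameter (U i) powr \<alpha>) \<le> diameter_power s (U i)"
      proof (cases "s = 0")
        case True
        have "diameter (U i) powr \<alpha> \<le> 1" using d s by (intro powr_le1) auto
        then show ?thesis using True ne by (simp add: diameter_power_def)
      next
        case False
        have "diameter (U i) powr \<alpha> \<le> diameter (U i) powr s"
          using d s by (intro powr_mono') auto
        then show ?thesis using False ne by (simp add: diameter_power_def ennreal_leI)
      qed
      moreover have "emeasure lborel (W i) = ennreal (2 * C) * ennreal (diameter (U i) powr \<alpha>)"
        using False C by (simp add: W_def cball_eq_atLeastAtMost ennreal_mult[symmetric])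
      ultimately show ?thesis by (simp add: mult_left_mono)
    qed (simp add: W_def)
    have "{0<..<1} \<subseteq> (\<Union>i. V i)" using g U(2) by (fastforce simp: V_def)
    then have sub: "{0<..<1} \<subseteq> (\<Union>i. W i)" using VW by blast
    have "1 = emeasure lborel {0<..<(1::real)}" by simp
    also have "\<dots> \<le> emeasure lborel (\<Union>i. W i)"
      by (rule emeasure_mono[OF sub]) (auto simp: W_def)
    also have "\<dots> \<le> (\<Sum>i. emeasure lborel (W i))"
      by (rule emeasure_subadditive_countably) (auto simp: W_def)
    also have "\<dots> \<le> (\<Sum>i. ennreal (2 * C) * diameter_power s (U i))"
      by (intro suminf_le W) auto
    also have "\<dots> = ennreal (2 * C) * (\<Sum>i. diameter_power s (U i))"
      by (rule ennreal_suminf_cmult)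
    finally have "ennreal (1 / (2 * C)) * 1
        \<le> ennreal (1 / (2 * C)) * (ennreal (2 * C) * (\<Sum>i. diameter_power s (U i)))"
      by (intro mult_left_mono) auto
    also have "\<dots> = (\<Sum>i. diameter_power s (U i))"
      using C by (simp add: mult.assoc[symmetric] ennreal_mult[symmetric])
    finally show ?thesis by simp
  qed
  then have "ennreal (1 / (2 * C)) \<le> hausdorff_premeasure s 1 A"
    unfolding hausdorff_premeasure_def by (intro INF_greatest) auto
  also have "\<dots> \<le> hausdorff_measure s A"
    unfolding hausdorff_measure_def by (intro SUP_upper) auto
  finally show ?thesis using C by (auto simp: ennreal_eq_0_iff)
qed

section \<open>The ternary Cantor set\<close>

text \<open>With digits 0 and 1 only, the values form the middle-thirds Cantor set scaled by
  1/2.\<close>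

definition ternary_series :: "(nat \<Rightarrow> nat) \<Rightarrow> real" where
  "ternary_series b = (\<Sum>i. real (b i) / 3 ^ Suc i)"

text \<open>The most significant digit is \<open>b 0\<close>. For digits 0 and 1 this is the integer
  part of \<open>3 ^ L * ternary_series b\<close>.\<close>

primrec ternary_prefix :: "(nat \<Rightarrow> nat) \<Rightarrow> nat \<Rightarrow> nat" where
  "ternary_prefix b 0 = 0"
| "ternary_prefix b (Suc L) = 3 * ternary_prefix b L + b L"

lemma omits_digit_two_ternary_prefix:
  assumes "\<And>i. b i \<le> 1"
  shows "omits_digit_two (ternary_prefix b L)"
proof (induction L)
  case (Suc L)
  have "b L < 3" "b L \<le> 1" using assms[of L] by auto
  then show ?case using Suc omits_digit_two_snoc_iff by simp
qed (simp add: omits_digit_two_0)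

lemma ternary_prefix_cong:
  "(\<And>i. i < L \<Longrightarrow> b i = c i) \<Longrightarrow> ternary_prefix b L = ternary_prefix c L"
  by (induction L) auto

lemma sums_one_half: "(\<lambda>i. 1 / 3 ^ Suc i :: real) sums (1 / 2)"
proof -
  have "(\<lambda>i. (1 / 3) * (1 / 3 :: real) ^ i) sums ((1 / 3) * (1 / (1 - 1 / 3)))"
    by (intro sums_mult geometric_sums) simp
  then show ?thesis by (simp add: power_one_over)
qed

lemma ternary_series_summable:
  assumes "\<And>i. b i \<le> 1"
  shows "summable (\<lambda>i. real (b i) / 3 ^ Suc i)"
proof (rule summable_comparison_test'[OF sums_summable[OF sums_one_half]])
  fix n show "norm (real (b n) / 3 ^ Suc n) \<le> 1 / 3 ^ Suc n"
    using assms[of n] by (simp add: divide_right_mono)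
qed

text \<open>The extreme case is the expansion with all digits 1. The gap between 1/2 and 1 is what
  both the separation of points and the stability of integer parts rely on.\<close>

lemma ternary_series_bounds:
  assumes "\<And>i. b i \<le> 1"
  shows "0 \<le> ternary_series b" "ternary_series b \<le> 1 / 2"
proof -
  show "0 \<le> ternary_series b"
    unfolding ternary_series_def by (intro suminf_nonneg ternary_series_summable assms) auto
  have "ternary_series b \<le> (\<Sum>i. 1 / 3 ^ Suc i)"
    unfolding ternary_series_def
    by (intro suminf_le ternary_series_summable assms sums_summable[OF sums_one_half])
      (use assms in \<open>auto simp: divide_right_mono\<close>)
  then show "ternary_series b \<le> 1 / 2"
    using sums_unique[OF sums_one_half] by simp
qed

lemma ternary_series_shift:
  assumes "\<And>i. b i \<le> 1"
  shows "3 * ternary_series b = real (b 0) + ternary_series (\<lambda>i. b (Suc i))"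
proof -
  have "ternary_series b = (\<Sum>i. real (b (Suc i)) / 3 ^ Suc (Suc i)) + real (b 0) / 3 ^ Suc 0"
    using suminf_split_head[OF ternary_series_summable, of b] assms
    by (simp add: ternary_series_def)
  also have "(\<Sum>i. real (b (Suc i)) / 3 ^ Suc (Suc i)) = (\<Sum>i. (1 / 3) * (real (b (Suc i)) / 3 ^ Suc i))"
    by simp
  also have "\<dots> = (1 / 3) * ternary_series (\<lambda>i. b (Suc i))"
    unfolding ternary_series_def by (rule suminf_mult) (rule ternary_series_summable[of "\<lambda>i. b (Suc i)"], rule assms)
  finally show ?thesis by simp
qed

lemma ternary_series_mult_power:
  assumes "\<And>i. b i \<le> 1"
  shows "3 ^ L * ternary_series b = real (ternary_prefix b L) + ternary_series (\<lambda>i. b (i + L))"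
proof (induction L)
  case (Suc L)
  have "3 ^ Suc L * ternary_series b = 3 * real (ternary_prefix b L) + 3 * ternary_series (\<lambda>i. b (i + L))"
    using Suc by simp
  also have "3 * ternary_series (\<lambda>i. b (i + L)) = real (b L) + ternary_series (\<lambda>i. b (Suc i + L))"
    using ternary_series_shift[of "\<lambda>i. b (i + L)"] assms by simp
  finally show ?case by simp
qed simp

text \<open>Scaling by \<open>3 ^ Suc k\<close> cancels the common prefix, turns the first differing
  digit into a difference of exactly 1, and leaves tails that differ by at most 1/2. So at least 1/2
  remains, and 6 is 2 times the extra factor 3.\<close>

lemma ternary_series_separation:
  assumes b: "\<And>i. b i \<le> 1" and c: "\<And>i. c i \<le> 1"
    and eq: "\<And>i. i < k \<Longrightarrow> b i = c i" and ne: "b k \<noteq> c k"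
  shows "1 \<le> 6 * 3 ^ k * \<bar>ternary_series b - ternary_series c\<bar>"
proof -
  have p: "ternary_prefix b k = ternary_prefix c k"
    using eq by (rule ternary_prefix_cong)
  have "3 ^ Suc k * ternary_series b - 3 ^ Suc k * ternary_series c
      = (real (b k) - real (c k))
        + (ternary_series (\<lambda>i. b (i + Suc k)) - ternary_series (\<lambda>i. c (i + Suc k)))"
    unfolding ternary_series_mult_power[of b, OF b] ternary_series_mult_power[of c, OF c] by (simp add: p)
  moreover have "\<bar>real (b k) - real (c k)\<bar> = 1"
    using b[of k] c[of k] ne by (auto simp: le_Suc_eq)
  moreover have "\<bar>ternary_series (\<lambda>i. b (i + Suc k)) - ternary_series (\<lambda>i. c (i + Suc k))\<bar> \<le> 1 / 2"
    using ternary_series_bounds[of "\<lambda>i. b (i + Suc k)", OF b]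
      ternary_series_bounds[of "\<lambda>i. c (i + Suc k)", OF c] by linarith
  ultimately have "1 / 2 \<le> \<bar>3 ^ Suc k * ternary_series b - 3 ^ Suc k * ternary_series c\<bar>"
    by linarith
  also have "\<dots> = 3 ^ Suc k * \<bar>ternary_series b - ternary_series c\<bar>"
    by (simp add: right_diff_distrib[symmetric] abs_mult)
  finally show ?thesis by simp
qed

definition binary_digit :: "real \<Rightarrow> nat \<Rightarrow> nat" where
  "binary_digit t i = nat \<lfloor>t * 2 ^ Suc i\<rfloor> mod 2"

lemma binary_digit_le_1: "binary_digit t i \<le> 1"
proof -
  have "binary_digit t i < 2" by (simp add: binary_digit_def)
  then show ?thesis by simp
qed

text \<open>Passing from \<open>k\<close> to \<open>k + 1\<close> doubles the integer part and adds
  the next digit, so the first \<open>k\<close> digits determine it.\<close>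

lemma floor_binary_cong:
  assumes s: "0 \<le> s" "s < 1" and t: "0 \<le> t" "t < 1"
    and eq: "\<And>i. i < k \<Longrightarrow> binary_digit s i = binary_digit t i"
  shows "\<lfloor>s * 2 ^ k\<rfloor> = \<lfloor>t * 2 ^ k\<rfloor>"
  using eq
proof (induction k)
  case 0
  have "\<lfloor>s\<rfloor> = 0" "\<lfloor>t\<rfloor> = 0" using s t by (auto simp: floor_eq_iff)
  then show ?case by simp
next
  case (Suc k)
  have step: "\<lfloor>x * 2 ^ Suc k\<rfloor> = 2 * \<lfloor>x * 2 ^ k\<rfloor> + int (binary_digit x k)" if "x \<ge> 0" for x :: real
  proof -
    have "\<lfloor>x * 2 ^ Suc k\<rfloor> div 2 = \<lfloor>x * 2 ^ k\<rfloor>"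
      using floor_divide_real_eq_div[of 2 "x * 2 ^ Suc k"] by simp
    moreover have "\<lfloor>x * 2 ^ Suc k\<rfloor> mod 2 = int (binary_digit x k)"
      using that by (simp add: binary_digit_def zmod_int)
    ultimately show ?thesis by (metis mult_div_mod_eq)
  qed
  show ?case unfolding step[OF s(1)] step[OF t(1)] using Suc by simp
qed

text \<open>If \<open>k\<close> is the first place where the binary digits differ, then
  \<open>s\<close> and \<open>t\<close> are within \<open>1 / 2 ^ k\<close>, while the ternary
  values are at least \<open>1 / (6 * 3 ^ k)\<close> apart. The exponent \<open>log 3 2\<close>
  converts \<open>3 ^ k\<close> into \<open>2 ^ k\<close>.\<close>

lemma cantor_Hoelder:
  assumes s: "0 \<le> s" "s < 1" and t: "0 \<le> t" "t < 1"
  shows "\<bar>s - t\<bar> \<le> (6 * \<bar>ternary_series (binary_digit s) - ternary_series (binary_digit t)\<bar>) powr log 3 2"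
proof -
  have close: "\<bar>s - t\<bar> * 2 ^ k \<le> 1" if "\<And>i. i < k \<Longrightarrow> binary_digit s i = binary_digit t i" for k
  proof -
    have "\<lfloor>s * 2 ^ k\<rfloor> = \<lfloor>t * 2 ^ k\<rfloor>" using floor_binary_cong[OF s t that] .
    then have "\<bar>s * 2 ^ k - t * 2 ^ k\<bar> \<le> 1" by linarith
    then show ?thesis by (simp add: left_diff_distrib[symmetric] abs_mult)
  qed
  show ?thesis
  proof (cases "s = t")
    case False
    have "\<exists>k. binary_digit s k \<noteq> binary_digit t k"
    proof (rule ccontr)
      assume "\<not> ?thesis"
      then have *: "\<bar>s - t\<bar> * 2 ^ k \<le> 1" for k using close by blast
      obtain k where "1 / \<bar>s - t\<bar> < 2 ^ k" using real_arch_pow[of 2] by auto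
      then have "1 < 2 ^ k * \<bar>s - t\<bar>" using False by (simp add: pos_divide_less_eq)
      then show False using *[of k] by (simp add: mult.commute)
    qed
    then obtain k where k: "binary_digit s k \<noteq> binary_digit t k"
        "\<And>i. i < k \<Longrightarrow> binary_digit s i = binary_digit t i"
      using exists_least_iff[of "\<lambda>k. binary_digit s k \<noteq> binary_digit t k"] by blast
    let ?D = "6 * \<bar>ternary_series (binary_digit s) - ternary_series (binary_digit t)\<bar>"
    have "1 \<le> 3 ^ k * ?D"
      using ternary_series_separation[of "binary_digit s" "binary_digit t" k,
          OF binary_digit_le_1 binary_digit_le_1 k(2,1)]
      by (simp only: mult_ac)
    then have "1 \<le> (3 ^ k * ?D) powr log 3 2"
      by (intro ge_one_powr_ge_zero) auto
    also have "\<dots> = 2 ^ k * ?D powr log 3 2"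
      by (simp add: powr_mult three_power_powr)
    finally have "1 \<le> ?D powr log 3 2 * 2 ^ k"
      by (simp only: mult.commute)
    with close[of k, OF k(2)] have "\<bar>s - t\<bar> * 2 ^ k \<le> ?D powr log 3 2 * 2 ^ k"
      by (rule order_trans)
    then show ?thesis by simp
  qed simp
qed

section \<open>Powers of 2 and 3\<close>

text \<open>A rational value would make a positive power of 2 equal to a power of 3, against
  parity.\<close>

lemma log_2_3_irrational: "log 2 3 \<notin> \<rat>"
proof
  assume "log 2 3 \<in> \<rat>"
  then obtain p q :: int where pq: "q > 0" "log 2 3 = p / q"
    by (metis Rats_cases')
  have "log 2 3 > (0::real)" by simp
  then have "p > 0" using pq by (simp add: zero_less_divide_iff)
  have "(3::real) ^ nat q = 2 powr (log 2 3 * q)"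
    using pq(1) by (simp add: powr_powr[symmetric] powr_realpow[symmetric])
  also have "log 2 3 * q = real (nat p)" using pq \<open>p > 0\<close> by simp
  finally have "real (3 ^ nat q) = real (2 ^ nat p)"
    by (simp add: powr_realpow)
  then have "(3::nat) ^ nat q = 2 ^ nat p" by (simp only: of_nat_eq_iff)
  moreover have "even ((2::nat) ^ nat p)" using \<open>p > 0\<close> by simp
  moreover have "odd ((3::nat) ^ nat q)" by simp
  ultimately show False by simp
qed

text \<open>On the logarithmic scale the quotients are the numbers \<open>L * log 2 3 - n\<close>,
  which Kronecker's theorem makes dense. The remaining work is to make \<open>n\<close> nonnegative
  and at least \<open>N\<close>.\<close>

lemma power_3_over_power_2_dense:
  fixes a b :: real
  assumes ab: "0 < a" "a < b"
  obtains n L :: nat where "n \<ge> N" "a < 3 ^ L / 2 ^ n" "3 ^ L / 2 ^ n < b"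
proof -
  \<comment> \<open>Shrinking the interval below 1 forces the approximating logarithm to be
    negative, hence \<open>h > 0\<close>. Undoing the shrinking adds \<open>N\<close> to the
    exponent of 2, so that it is at least \<open>N\<close>.\<close>
  obtain P where P: "b * 2 ^ N < 3 ^ P" using real_arch_pow[of 3] by auto
  define A B where "A = a * 2 ^ N / 3 ^ P" and "B = b * 2 ^ N / 3 ^ P"
  have AB: "0 < A" "A < B" "B < 1"
    using ab P by (auto simp: A_def B_def divide_strict_right_mono)
  \<comment> \<open>Half the length of the logarithmic interval; its midpoint is the number
    approximated.\<close>
  define \<epsilon> where "\<epsilon> = (log 2 B - log 2 A) / 2"
  have "\<epsilon> > 0" using AB by (simp add: \<epsilon>_def)
  then obtain h k :: int where hk: "k > 0" "\<bar>of_int k * log 2 3 - of_int h - (log 2 A + log 2 B) / 2\<bar> < \<epsilon>"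
    using sequence_of_fractional_parts_is_dense[OF log_2_3_irrational] by metis
  define x where "x = of_int k * log 2 3 - of_int h"
  have x: "log 2 A < x" "x < log 2 B"
    using hk(2) unfolding x_def[symmetric] \<epsilon>_def by (auto simp: abs_less_iff field_simps)
  have "log 2 B < 0" using AB by simp
  then have "of_int k * log 2 3 < of_int h" using x by (simp add: x_def)
  moreover have "of_int k * log 2 3 > (0::real)" using hk(1) by simp
  ultimately have h: "h > 0" by linarith
  have "2 powr x = 3 ^ nat k / 2 ^ nat h"
  proof -
    have "2 powr (log 2 3 * of_int k) = (3::real) ^ nat k"
      using hk(1) by (subst powr_powr[symmetric]) (simp add: powr_realpow[symmetric])
    then show ?thesis
      using h by (simp add: x_def powr_diff mult.commute powr_realpow[symmetric])
  qed
  moreover have "A < 2 powr x" "2 powr x < B"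
    using x AB by (auto simp: log_less_iff less_log_iff)
  ultimately have "A < 3 ^ nat k / 2 ^ nat h" "3 ^ nat k / 2 ^ nat h < B" by auto
  then have "a < 3 ^ (nat k + P) / 2 ^ (nat h + N)" "3 ^ (nat k + P) / 2 ^ (nat h + N) < b"
    by (auto simp: A_def B_def power_add field_simps)
  then show ?thesis using that[of "nat h + N"] by simp
qed

lemma exists_floor_often_power_of_3:
  obtains \<theta> :: real where "\<theta> > 0" "\<And>N. \<exists>n\<ge>N. \<exists>L. 3 ^ L < \<theta> * 2 ^ n \<and> \<theta> * 2 ^ n < 3 ^ L + 1"
proof -
  \<comment> \<open>The negative half-line is adjoined to make \<open>G N\<close> dense in the whole
    line, where Baire's theorem is applied.\<close>
  define G :: "nat \<Rightarrow> real set" where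
    "G N = {..<0} \<union> (\<Union>n\<in>{N..}. \<Union>L. {3 ^ L / 2 ^ n<..<(3 ^ L + 1) / 2 ^ n})" for N
  have "UNIV \<subseteq> closure (G N)" for N
  proof
    fix x :: real
    show "x \<in> closure (G N)"
    proof (cases "x \<le> 0")
      case True
      have "closure {..<0} \<subseteq> closure (G N)" by (rule closure_mono) (auto simp: G_def)
      then show ?thesis using True by (auto simp: closure_lessThan)
    next
      case False
      show ?thesis unfolding closure_approachable
      proof (intro allI impI)
        fix e :: real assume "e > 0"
        with False obtain n L where nL: "n \<ge> N" "x < 3 ^ L / 2 ^ n" "3 ^ L / 2 ^ n < x + e"
          using power_3_over_power_2_dense[of x "x + e" N] by auto
        have "3 ^ L / 2 ^ n < (3 ^ L + 1 :: real) / 2 ^ n" by (simp add: divide_strict_right_mono)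
        then have "3 ^ L / 2 ^ n < min (x + e) ((3 ^ L + 1) / 2 ^ n)" using nL by simp
        then obtain y where y: "3 ^ L / 2 ^ n < y" "y < min (x + e) ((3 ^ L + 1) / 2 ^ n)"
          using dense by blast
        then have "y \<in> G N" using nL(1) by (auto simp: G_def)
        moreover have "dist y x < e" using y nL by (auto simp: dist_real_def)
        ultimately show "\<exists>y\<in>G N. dist y x < e" by blast
      qed
    qed
  qed
  moreover have "open (G N)" for N
    unfolding G_def by (intro open_Un open_UN ballI open_lessThan open_greaterThanLessThan)
  ultimately have "UNIV \<subseteq> closure (\<Inter>(range G))"
    by (intro Baire) auto
  \<comment> \<open>A point within distance 1 of 1 is positive, so it lies in the intervals of
    \<open>G N\<close> and not in the half-line.\<close>
  then obtain \<theta> where \<theta>: "\<theta> \<in> \<Inter>(range G)" "dist \<theta> 1 < 1"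
    unfolding closure_approachable subset_iff by (metis UNIV_I zero_less_one)
  show ?thesis
  proof
    show "\<theta> > 0" using \<theta>(2) by (auto simp: dist_real_def)
    show "\<exists>n\<ge>N. \<exists>L. 3 ^ L < \<theta> * 2 ^ n \<and> \<theta> * 2 ^ n < 3 ^ L + 1" for N
    proof -
      have "\<theta> \<in> G N" using \<theta>(1) by auto
      then show ?thesis using \<open>\<theta> > 0\<close> by (fastforce simp: G_def field_simps)
    qed
  qed
qed

section \<open>The lower bound\<close>

lemma scaled_cantor_in_truncated_exceptional_set:
  assumes \<theta>: "\<theta> > 0" "\<And>N. \<exists>n\<ge>N. \<exists>L. 3 ^ L < \<theta> * 2 ^ n \<and> \<theta> * 2 ^ n < 3 ^ L + 1"
    and b: "\<And>i. b i \<le> 1" and pos: "ternary_series b > 0"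
  shows "\<theta> * ternary_series b \<in> truncated_exceptional_set"
proof -
  let ?c = "ternary_series b"
  have "\<exists>n\<ge>N. omits_digit_two (nat \<lfloor>\<theta> * ?c * 2 ^ n\<rfloor>)" for N
  proof -
    obtain n L where nL: "n \<ge> N" "3 ^ L < \<theta> * 2 ^ n" "\<theta> * 2 ^ n < 3 ^ L + 1"
      using \<theta>(2) by blast
    define \<delta> where "\<delta> = \<theta> * 2 ^ n - 3 ^ L"
    have \<delta>: "0 < \<delta>" "\<delta> < 1" using nL by (auto simp: \<delta>_def)
    let ?t = "ternary_series (\<lambda>i. b (i + L))"
    have "\<theta> * ?c * 2 ^ n = 3 ^ L * ?c + \<delta> * ?c" by (simp add: \<delta>_def algebra_simps)
    also have "3 ^ L * ?c = real (ternary_prefix b L) + ?t"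
      using b by (rule ternary_series_mult_power)
    finally have eq: "\<theta> * ?c * 2 ^ n = real (ternary_prefix b L) + (?t + \<delta> * ?c)" by simp
    have "0 \<le> ?t" "?t \<le> 1 / 2" using ternary_series_bounds[of "\<lambda>i. b (i + L)"] b by auto
    \<comment> \<open>Strictness matters: both summands can come close to 1/2, and their sum must
      stay below 1 to leave the integer part unchanged.\<close>
    moreover have "\<delta> * ?c < 1 * ?c" using \<delta> pos by (intro mult_strict_right_mono) auto
    moreover have "?c \<le> 1 / 2" using ternary_series_bounds[of b] b by auto
    moreover have "0 \<le> \<delta> * ?c" using \<delta> pos by simp
    ultimately have "0 \<le> ?t + \<delta> * ?c" "?t + \<delta> * ?c < 1" by linarith+
    then have "\<lfloor>\<theta> * ?c * 2 ^ n\<rfloor> = int (ternary_prefix b L)"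
      unfolding eq by (simp add: floor_eq_iff)
    then show ?thesis using nL(1) omits_digit_two_ternary_prefix[of b L] b by (metis nat_int)
  qed
  then have "infinite {n. omits_digit_two (nat \<lfloor>\<theta> * ?c * 2 ^ n\<rfloor>)}"
    unfolding infinite_nat_iff_unbounded_le by blast
  then show ?thesis using \<theta>(1) pos by (simp add: truncated_exceptional_set_def)
qed

lemma hausdorff_measure_truncated_exceptional_set_nonzero:
  assumes s: "0 \<le> s" "s \<le> log 3 2"
  shows "hausdorff_measure s truncated_exceptional_set \<noteq> 0"
proof -
  obtain \<theta> :: real where \<theta>: "\<theta> > 0"
      "\<And>N. \<exists>n\<ge>N. \<exists>L. 3 ^ L < \<theta> * 2 ^ n \<and> \<theta> * 2 ^ n < 3 ^ L + 1"
    using exists_floor_often_power_of_3 by blast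
  define g where "g t = \<theta> * ternary_series (binary_digit t)" for t
  show ?thesis
  proof (rule hausdorff_measure_nonzero_of_Hoelder[OF _ _ s])
    show "(6 / \<theta>) powr log 3 2 > 0" using \<theta>(1) by simp
    show "g ` {0<..<1} \<subseteq> truncated_exceptional_set"
    proof (rule image_subsetI)
      fix t :: real assume t: "t \<in> {0<..<1}"
      \<comment> \<open>Comparing \<open>t\<close> with 0 in the Hoelder estimate shows that the
        value at \<open>t\<close> is nonzero, as membership in the exceptional set demands.\<close>
      have "ternary_series (binary_digit 0) = 0"
        by (simp add: ternary_series_def binary_digit_def)
      then have "ternary_series (binary_digit t) \<noteq> 0"
        using cantor_Hoelder[of t 0] t by auto
      then have "ternary_series (binary_digit t) > 0"
        using ternary_series_bounds(1)[of "binary_digit t"] binary_digit_le_1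
        by (metis order_le_imp_less_or_eq)
      then show "g t \<in> truncated_exceptional_set"
        unfolding g_def using scaled_cantor_in_truncated_exceptional_set[OF \<theta>] binary_digit_le_1
        by blast
    qed
    fix x y :: real assume xy: "x \<in> {0<..<1}" "y \<in> {0<..<1}"
    let ?D = "\<bar>ternary_series (binary_digit x) - ternary_series (binary_digit y)\<bar>"
    have "dist (g x) (g y) = \<theta> * ?D"
      using \<theta>(1) by (simp add: g_def dist_real_def right_diff_distrib[symmetric] abs_mult)
    then have "6 * ?D = (6 / \<theta>) * dist (g x) (g y)" using \<theta>(1) by simp
    then have "(6 * ?D) powr log 3 2 = (6 / \<theta>) powr log 3 2 * dist (g x) (g y) powr log 3 2"
      using \<theta>(1) by (simp only: powr_mult)
    then show "dist x y \<le> (6 / \<theta>) powr log 3 2 * dist (g x) (g y) powr log 3 2"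
      using cantor_Hoelder[of x y] xy by (simp add: dist_real_def)
  qed
qed

theorem theorem1p3:
  shows "hausdorff_dim truncated_exceptional_set = ennreal (log 3 2)
    \<and> log 3 2 = ln 2 / (ln 3 :: real)
    \<and> hausdorff_measure (log 3 2) truncated_exceptional_set \<noteq> 0"
proof (intro conjI)
  have \<alpha>: "log 3 2 > (0::real)" by simp
  show "hausdorff_dim truncated_exceptional_set = ennreal (log 3 2)"
    unfolding hausdorff_dim_def
  proof (rule antisym)
    show "ennreal (log 3 2) \<le> Inf {ennreal s |s. s \<ge> 0 \<and> hausdorff_measure s truncated_exceptional_set = 0}"
      using hausdorff_measure_truncated_exceptional_set_nonzero
      by (intro Inf_greatest) (fastforce intro: ennreal_leI simp: not_le[symmetric])
    show "Inf {ennreal s |s. s \<ge> 0 \<and> hausdorff_measure s truncated_exceptional_set = 0} \<le> ennreal (log 3 2)"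
    \<comment> \<open>The vanishing of the measure is known only strictly above
      \<open>log 3 2\<close>, so the infimum is approached through
      \<open>log 3 2 + e\<close>.\<close>
    proof (rule ennreal_le_epsilon)
      fix e :: real assume "0 < e"
      have "Inf {ennreal s |s. s \<ge> 0 \<and> hausdorff_measure s truncated_exceptional_set = 0}
          \<le> ennreal (log 3 2 + e)"
        using hausdorff_measure_truncated_exceptional_set_eq_0[of "log 3 2 + e"] \<open>0 < e\<close> \<alpha>
        by (intro Inf_lower CollectI exI[of _ "log 3 2 + e"]) simp
      then show "Inf {ennreal s |s. s \<ge> 0 \<and> hausdorff_measure s truncated_exceptional_set = 0}
          \<le> ennreal (log 3 2) + ennreal e"
        using \<open>0 < e\<close> \<alpha> by simp
    qed
  qed
  show "log 3 2 = ln 2 / (ln 3 :: real)" by (rule log_def)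
  show "hausdorff_measure (log 3 2) truncated_exceptional_set \<noteq> 0"
    using \<alpha> by (intro hausdorff_measure_truncated_exceptional_set_nonzero) auto
qed

end
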